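(* (Weak concentration) Let $(\Omega,\mu)$ be a probability measure space. For any probability density $F$ on $\Omega$ and any $0<\varepsilon<1$ there exists a set $A\subset\Omega$ with $\mu(A)=V^{1-\varepsilon}$ such that $$\varepsilon H\le\int_AF\ln F\,d\mu.$$
   Context: A probability density (distribution) on $\Omega$ is a function $F\ge0$ with $\int_\Omega F\,d\mu=1$. Its entropy is $H=\int_\Omega F\ln F\,d\mu$ and its volumetric factor is $V=e^{-H}$.
   Formalization: The measure μ is additionally assumed to have no atoms (on two points of mass 1/2 with F = (3/2, 1/2) no set has measure V^{1-ε}), and the entropy H is assumed finite (for H = +∞ one has V = 0 and the claim would read ∞ ≤ 0). *)

theory Defs
  imports "HOL-Probability.Probability_Measure"
begin

(* Integrability is required separately because the Bochner integral of a
   non-integrable function is 0 by convention. *)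
definition prob_density :: "'a measure \<Rightarrow> ('a \<Rightarrow> real) \<Rightarrow> bool" where
  "prob_density M F \<longleftrightarrow>
     (\<forall>x\<in>space M. 0 \<le> F x) \<and> integrable M F \<and> (LINT x|M. F x) = 1"

(* The convention 0 ln 0 = 0 holds automatically.  Since F ln F is bounded below by
   -1/e, on a probability space the entropy is always defined in (-infinity, infinity];
   it is finite iff F ln F is integrable, and only then is the real number below
   the entropy. *)
definition dens_entropy :: "'a measure \<Rightarrow> ('a \<Rightarrow> real) \<Rightarrow> real" where
  "dens_entropy M F = (LINT x|M. F x * ln (F x))"

definition finite_dens_entropy :: "'a measure \<Rightarrow> ('a \<Rightarrow> real) \<Rightarrow> bool" where
  "finite_dens_entropy M F \<longleftrightarrow> integrable M (\<lambda>x. F x * ln (F x))"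

definition volumetric_factor :: "'a measure \<Rightarrow> ('a \<Rightarrow> real) \<Rightarrow> real" where
  "volumetric_factor M F = exp (- dens_entropy M F)"

(* Without this, sets of a prescribed measure need not exist: on two points of mass 1/2
   only the values 0, 1/2 and 1 are attained. *)
definition nonatomic :: "'a measure \<Rightarrow> bool" where
  "nonatomic M \<longleftrightarrow>
     (\<forall>A\<in>sets M. 0 < emeasure M A \<longrightarrow>
        (\<exists>B\<in>sets M. B \<subseteq> A \<and> 0 < emeasure M B \<and> emeasure M B < emeasure M A))"

end

theory Submission
  imports Defs
begin

text \<open>
  Write \<open>m = V powr (1 - \<epsilon>) = exp (- (1 - \<epsilon>) * H)\<close> for the prescribed measure. The set \<open>A\<close> has to
  carry so much of the entropy that at most \<open>(1 - \<epsilon>) * H = ln (1 / m)\<close> is left over on its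
  complement. As \<open>F\<close> has total mass \<open>1\<close>, it suffices that \<open>F \<le> 1 / m\<close> off \<open>A\<close>: there
  \<open>F ln F \<le> F ln (1 / m)\<close>, and the integral of the right-hand side is at most \<open>ln (1 / m)\<close>, which
  is nonnegative because \<open>H \<ge> 0\<close> (\<open>dens_entropy_nonneg\<close>). So every \<open>A\<close> of measure \<open>m\<close> that
  contains \<open>{F \<ge> 1 / m}\<close> will do.

  By Markov's inequality \<open>{F \<ge> 1 / m}\<close> has measure at most \<open>m\<close>, and \<open>m \<le> 1\<close> since \<open>H \<ge> 0\<close>. What
  remains is to enlarge a set of measure at most \<open>m\<close> to one of measure exactly \<open>m\<close>. This is
  Sierpinski's theorem that a finite nonatomic measure takes all intermediate values
  (\<open>nonatomic_intermediate_value\<close>).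
\<close>

lemma (in finite_measure) nonatomic_halving:
  assumes "nonatomic M" "A \<in> sets M" "0 < measure M A"
  shows "\<exists>B\<in>sets M. B \<subseteq> A \<and> 0 < measure M B \<and> measure M B \<le> measure M A / 2"
proof -
  have "0 < emeasure M A"
    using assms(3) by (simp add: emeasure_eq_measure)
  then obtain B where B: "B \<in> sets M" "B \<subseteq> A" "0 < emeasure M B" "emeasure M B < emeasure M A"
    using assms(1,2) unfolding nonatomic_def by blast
  have "0 < measure M B" "measure M B < measure M A"
    using B(3,4) by (simp_all add: emeasure_eq_measure ennreal_less_iff)
  moreover have "measure M (A - B) = measure M A - measure M B"
    using B(1,2) assms(2) by (rule_tac finite_measure_Diff) auto
  \<comment> \<open>One of \<open>B\<close> and \<open>A - B\<close> has at most half of the measure.\<close>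
  ultimately consider "measure M B \<le> measure M A / 2"
    | "0 < measure M (A - B)" "measure M (A - B) \<le> measure M A / 2"
    by linarith
  then show ?thesis
  proof cases
    case 1
    then show ?thesis using B \<open>0 < measure M B\<close> by blast
  next
    case 2
    then show ?thesis using B(1) assms(2) by blast
  qed
qed

lemma (in finite_measure) nonatomic_small_subset:
  assumes "nonatomic M" "A \<in> sets M" "0 < measure M A" "0 < \<delta>"
  shows "\<exists>B\<in>sets M. B \<subseteq> A \<and> 0 < measure M B \<and> measure M B \<le> \<delta>"
proof -
  have halved: "\<exists>B\<in>sets M. B \<subseteq> A \<and> 0 < measure M B \<and> measure M B \<le> measure M A / 2 ^ n" for n
  proof (induction n)
    case 0
    then show ?case using assms by auto
  next
    case (Suc n)
    then obtain B where B: "B \<in> sets M" "B \<subseteq> A" "0 < measure M B"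
        "measure M B \<le> measure M A / 2 ^ n" by blast
    obtain C where C: "C \<in> sets M" "C \<subseteq> B" "0 < measure M C" "measure M C \<le> measure M B / 2"
      using nonatomic_halving[OF assms(1) B(1,3)] by blast
    have "measure M C \<le> measure M A / 2 ^ Suc n"
      using B(4) C(4) by simp
    then show ?case using B C by blast
  qed
  obtain n where "measure M A / \<delta> < 2 ^ n"
    using real_arch_pow[of 2 "measure M A / \<delta>"] by auto
  then have "measure M A / 2 ^ n \<le> \<delta>"
    using assms(4) by (simp add: field_simps)
  moreover obtain B where "B \<in> sets M" "B \<subseteq> A" "0 < measure M B" "measure M B \<le> measure M A / 2 ^ n"
    using halved by blast
  ultimately show ?thesis by (intro bexI[of _ B]) auto
qed

text \<open>
  A greedy choice among the subsets of \<open>T\<close> of measure at most \<open>r\<close>. The largest possible measure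
  need not be attained a priori, so only half of the supremum is asked for.
\<close>

lemma (in finite_measure) greedy_subset:
  assumes "0 \<le> r"
  shows "\<exists>D\<in>sets M. D \<subseteq> T \<and> measure M D \<le> r \<and>
           (\<forall>E\<in>sets M. E \<subseteq> T \<longrightarrow> measure M E \<le> r \<longrightarrow> measure M E \<le> 2 * measure M D)"
proof -
  define X where "X = measure M ` {D \<in> sets M. D \<subseteq> T \<and> measure M D \<le> r}"
  have mem: "measure M D \<in> X" if "D \<in> sets M" "D \<subseteq> T" "measure M D \<le> r" for D
    using that by (auto simp: X_def)
  have zero: "0 \<in> X" using mem[of "{}"] assms by simp
  have bdd: "bdd_above X" by (rule bdd_aboveI[of _ r]) (auto simp: X_def)
  have "\<exists>D\<in>sets M. D \<subseteq> T \<and> measure M D \<le> r \<and> Sup X \<le> 2 * measure M D"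
  proof (cases "Sup X \<le> 0")
    case True
    then show ?thesis using assms by (intro bexI[of _ "{}"]) auto
  next
    case False
    then have "Sup X / 2 < Sup X" by simp
    then obtain x where x: "x \<in> X" "Sup X / 2 < x"
      using less_cSupE[of "Sup X / 2" X] zero by blast
    from x(1) obtain D where "D \<in> sets M" "D \<subseteq> T" "measure M D \<le> r" "x = measure M D"
      unfolding X_def by blast
    then show ?thesis using x(2) by (intro bexI[of _ D]) simp_all
  qed
  then obtain D where D: "D \<in> sets M" "D \<subseteq> T" "measure M D \<le> r" "Sup X \<le> 2 * measure M D"
    by blast
  have "measure M E \<le> 2 * measure M D" if "E \<in> sets M" "E \<subseteq> T" "measure M E \<le> r" for E
    using cSup_upper[OF mem[OF that] bdd] D(4) by simp
  then show ?thesis using D by blast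
qed

text \<open>
  Sierpinski's theorem. A set of measure \<open>t\<close> is exhausted from inside: starting from the empty set,
  greedily chosen pieces of \<open>S\<close> are added without exceeding \<open>t\<close>. If the union \<open>U\<close> stayed below
  \<open>t\<close>, nonatomicity would provide a piece \<open>E\<close> of \<open>S - U\<close> of positive measure that still fits. It
  would have fitted at every stage, so each greedy piece had measure at least half of that of \<open>E\<close>,
  and infinitely many of them cannot add up to at most \<open>t\<close>.
\<close>

lemma (in finite_measure) nonatomic_intermediate_value:
  assumes "nonatomic M" "S \<in> sets M" "0 \<le> t" "t \<le> measure M S"
  shows "\<exists>A\<in>sets M. A \<subseteq> S \<and> measure M A = t"
proof -
  define P where "P = (\<lambda>C. C \<in> sets M \<and> C \<subseteq> S \<and> measure M C \<le> t)"
  define Q where "Q = (\<lambda>C C'. C \<subseteq> C' \<and> (\<forall>E\<in>sets M. E \<subseteq> S - C \<longrightarrow> measure M E \<le> t - measure M C \<longrightarrow>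
      measure M E \<le> 2 * (measure M C' - measure M C)))"
  have step: "\<exists>C'. P C' \<and> Q C C'" if C: "P C" for C
  proof -
    obtain D where D: "D \<in> sets M" "D \<subseteq> S - C" "measure M D \<le> t - measure M C"
        "\<forall>E\<in>sets M. E \<subseteq> S - C \<longrightarrow> measure M E \<le> t - measure M C \<longrightarrow> measure M E \<le> 2 * measure M D"
      using greedy_subset[of "t - measure M C" "S - C"] C unfolding P_def by auto
    have "measure M (C \<union> D) = measure M C + measure M D"
      using C D unfolding P_def by (intro finite_measure_Union) auto
    then show ?thesis
      using C D unfolding P_def Q_def by (intro exI[of _ "C \<union> D"]) auto
  qed
  have "P {}" using assms(3) by (simp add: P_def)
  then have "\<exists>C. \<forall>n. P (C n) \<and> Q (C n) (C (Suc n))"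
    by (intro dependent_nat_choice) (use step in auto)
  then obtain C where C: "\<And>n. P (C n)" "\<And>n. Q (C n) (C (Suc n))"
    by blast
  define U where "U = (\<Union>n. C n)"
  have inc: "incseq C" using C(2) by (intro incseq_SucI) (auto simp: Q_def)
  have ran: "range C \<subseteq> sets M" using C(1) by (auto simp: P_def)
  have lim: "(\<lambda>n. measure M (C n)) \<longlonglongrightarrow> measure M U"
    unfolding U_def using finite_Lim_measure_incseq[OF ran inc] .
  have U: "U \<in> sets M" "U \<subseteq> S" "C n \<subseteq> U" for n
    using C(1) by (auto simp: U_def P_def)
  have le: "measure M U \<le> t"
    by (rule LIMSEQ_le_const2[OF lim]) (use C(1) in \<open>auto simp: P_def\<close>)
  have "measure M U = t"
  proof (rule ccontr)
    assume "measure M U \<noteq> t"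
    with le have less: "measure M U < t" by simp
    have "measure M (S - U) = measure M S - measure M U"
      using U(1,2) assms(2) by (intro finite_measure_Diff) auto
    then have "0 < measure M (S - U)" using less assms(4) by simp
    then obtain E where E: "E \<in> sets M" "E \<subseteq> S - U" "0 < measure M E" "measure M E \<le> t - measure M U"
      using nonatomic_small_subset[OF assms(1), of "S - U" "t - measure M U"] U(1) assms(2) less
      by auto
    have "measure M E \<le> 2 * (measure M (C (Suc n)) - measure M (C n))" for n
    proof -
      have "measure M (C n) \<le> measure M U"
        using U by (intro finite_measure_mono) auto
      then have "E \<subseteq> S - C n" "measure M E \<le> t - measure M (C n)"
        using E(2,4) U(3)[of n] by auto
      then show ?thesis using C(2)[of n] E(1) by (simp add: Q_def)
    qed
    moreover have "(\<lambda>n. 2 * (measure M (C (Suc n)) - measure M (C n))) \<longlonglongrightarrow>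
        2 * (measure M U - measure M U)"
      by (intro tendsto_intros lim LIMSEQ_Suc[OF lim])
    ultimately have "measure M E \<le> 2 * (measure M U - measure M U)"
      by (intro LIMSEQ_le_const) auto
    then show False using E(3) by simp
  qed
  then show ?thesis using U by blast
qed

text \<open>
  Jensen's inequality for \<open>x ln x\<close>, in the form that needs nothing but its tangent at \<open>x = 1\<close>:
  \<open>x - 1 \<le> x ln x\<close>, where the left-hand side integrates to \<open>0\<close>.
\<close>

lemma (in prob_space) dens_entropy_nonneg:
  assumes "prob_density M F" "finite_dens_entropy M F"
  shows "0 \<le> dens_entropy M F"
proof -
  have tangent: "x - 1 \<le> x * ln x" if "0 \<le> x" for x :: real
  proof (cases "x = 0")
    case False
    with that have x: "0 < x" by simp
    then have "ln (1 / x) \<le> 1 / x - 1" by (intro ln_le_minus_one) simp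
    moreover have "ln (1 / x) = - ln x" using x by (simp add: ln_div)
    ultimately have "1 - 1 / x \<le> ln x" by linarith
    then have "x * (1 - 1 / x) \<le> x * ln x" using x by (intro mult_left_mono) simp_all
    moreover have "x * (1 - 1 / x) = x - 1" using x by (simp add: right_diff_distrib)
    ultimately show ?thesis by simp
  qed simp
  have F: "\<And>x. x \<in> space M \<Longrightarrow> 0 \<le> F x" "integrable M F" "(LINT x|M. F x) = 1"
    using assms(1) by (auto simp: prob_density_def)
  have "0 = (LINT x|M. F x - 1)"
    using F by (simp add: prob_space)
  also have "\<dots> \<le> (LINT x|M. F x * ln (F x))"
    using assms(2) F tangent by (intro integral_mono) (auto simp: finite_dens_entropy_def)
  finally show ?thesis by (simp add: dens_entropy_def)
qed

theorem lemma3p4: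
  fixes M :: "'a measure" and F :: "'a \<Rightarrow> real" and \<epsilon> :: real
  assumes "prob_space M" and "nonatomic M"
    and "prob_density M F" and "finite_dens_entropy M F"
    and "0 < \<epsilon>" and "\<epsilon> < 1"
  shows "\<exists>A\<in>sets M. measure M A = volumetric_factor M F powr (1 - \<epsilon>) \<and>
           \<epsilon> * dens_entropy M F \<le> (LINT x:A|M. F x * ln (F x))"
proof -
  interpret prob_space M by fact
  define H where "H = dens_entropy M F"
  define c where "c = (1 - \<epsilon>) * H"
  define m where "m = exp (- c)"
  \<comment> \<open>Hence \<open>1 / m = exp c\<close>, and \<open>c\<close> is the entropy that may be left outside \<open>A\<close>.\<close>
  have F: "\<And>x. x \<in> space M \<Longrightarrow> 0 \<le> F x" "integrable M F" "(LINT x|M. F x) = 1"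
    using assms(3) by (auto simp: prob_density_def)
  have [measurable]: "F \<in> borel_measurable M" using F(2) by simp
  have int: "integrable M (\<lambda>x. F x * ln (F x))"
    using assms(4) by (simp add: finite_dens_entropy_def)
  have c0: "0 \<le> c"
    using dens_entropy_nonneg[OF assms(3,4)] assms(6) by (simp add: c_def H_def)
  have m: "volumetric_factor M F powr (1 - \<epsilon>) = m"
    by (simp add: volumetric_factor_def powr_def m_def c_def H_def)
  have m1: "m \<le> 1" "0 < m" using c0 by (simp_all add: m_def)

  define B where "B = {x \<in> space M. exp c \<le> F x}"
  have B: "B \<in> sets M" by (simp add: B_def)
  have "measure M B \<le> (LINT x|M. F x) / exp c"
    unfolding B_def using F by (intro integral_Markov_inequality_measure[where A="{}"]) auto
  then have Bm: "measure M B \<le> m" by (simp add: F(3) m_def exp_minus inverse_eq_divide)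
  obtain D where D: "D \<in> sets M" "D \<subseteq> space M - B" "measure M D = m - measure M B"
    using nonatomic_intermediate_value[OF assms(2), of "space M - B" "m - measure M B"]
      B Bm m1 prob_compl[OF B] by auto
  define A where "A = B \<union> D"
  have A: "A \<in> sets M" using B D by (simp add: A_def)
  have "measure M (B \<union> D) = measure M B + measure M D"
    using B D by (intro finite_measure_Union) auto
  then have Am: "measure M A = m" using D(3) by (simp add: A_def)

  have setint: "set_integrable M A (\<lambda>x. F x * ln (F x))"
    "set_integrable M (space M - A) (\<lambda>x. F x * ln (F x))"
    using int A unfolding set_integrable_def by (auto intro!: integrable_mult_indicator simp del: real_scaleR_def)
  have le: "indicator (space M - A) x * (F x * ln (F x)) \<le> c * F x" if x: "x \<in> space M" for x
  proof (cases "x \<in> A \<or> F x = 0")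
    case True
    then show ?thesis using c0 F(1)[OF x] by (auto simp: x)
  next
    case False
    then have pos: "0 < F x" and "F x \<le> exp c"
      using F(1)[OF x] x by (auto simp: A_def B_def)
    then have "ln (F x) \<le> c" using ln_le_cancel_iff[of "F x" "exp c"] by simp
    then have "F x * ln (F x) \<le> F x * c" using pos by (intro mult_left_mono) auto
    then show ?thesis using False x by (simp add: mult.commute)
  qed
  have "(LINT x:(space M - A)|M. F x * ln (F x)) \<le> (LINT x|M. c * F x)"
    unfolding set_lebesgue_integral_def real_scaleR_def
    using setint(2) F(2) le
    by (intro integral_mono) (auto simp: set_integrable_def)
  also have "\<dots> = c" by (simp add: F(3))
  finally have compl: "(LINT x:(space M - A)|M. F x * ln (F x)) \<le> c" .
  have "H = (LINT x:(A \<union> (space M - A))|M. F x * ln (F x))"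
    using A sets.sets_into_space[OF A]
    by (simp add: H_def dens_entropy_def Un_absorb1 set_integral_space[OF int])
  also have "\<dots> = (LINT x:A|M. F x * ln (F x)) + (LINT x:(space M - A)|M. F x * ln (F x))"
    by (rule set_integral_Un) (use setint in auto)
  finally have "\<epsilon> * H \<le> (LINT x:A|M. F x * ln (F x))"
    using compl by (simp add: c_def algebra_simps)
  then show ?thesis using A Am m by (auto simp: H_def)
qed

end
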